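(* Let $f:\mathcal H\to\mathcal H$ be sufficiently differentiable and Lipschitz continuous, and let it satisfy $\mathrm{Re}\,\langle v-w,f(v)-f(w)\rangle_{\mathcal H}\le\ell\,\|v-w\|_{\mathcal H}^2$ for all $v,w\in\mathcal H$. Let $y$ solve $\dot y=f(y)$, $y(0)=y_0$, on $[0,\bar t]$, and let $u_n=\Phi(\theta_n)$ be the results of the regularized $p$-th order explicit Runge--Kutta method with variable stepsizes $h_n>0$, $t_0=0$, $t_{n+1}=t_n+h_n$, $t_N=\bar t$, regularization parameters $\varepsilon_n>0$ and initial value $y_0=u_0=\Phi(\theta_0)$. Let $c>0$ and assume the stepsize restriction $$h_n\,\delta_{n,i}\le c\,\varepsilon_n^2,\qquad 0\le n\le N,\ \ i=1,\dots,s.$$ Then, for $t_n\le\bar t$, $$\|u_n-y(t_n)\|_{\mathcal H}=O(\delta+h^p)$$ with $\delta=\max_{n,i}\delta_{n,i}$ and $h=\max_nh_n$. The constants symbolized by the $O$-notation are independent of $\delta$ and the regularization parameters $\varepsilon_n$ (under the given stepsize restriction), and of the stepsize sequence $(h_k)$ and $n$ with $t_n\le\bar t$.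
   Context: $\mathcal H$ is a (real or complex) Hilbert space, $\mathcal Q$ a finite-dimensional inner product space, $\Phi:\mathcal Q\to\mathcal H$ twice continuously differentiable with bounded second derivatives (no injectivity or full rank of $\Phi'$ is assumed). Regularized explicit Runge--Kutta method with coefficients $a_{ij},b_j$ ($s$ stages) of an explicit Runge--Kutta method of order $p$: starting from $\theta_n$ at time $t_n$ with stepsize $h_n$, compute consecutively for $i=1,\dots,s$ $$\theta_{n,i}=\theta_n+h_n\sum_{j=1}^{i-1}a_{ij}\dot\theta_{n,j},\qquad u_{n,i}=\Phi(\theta_{n,i}),$$ and $\dot\theta_{n,i}\in\mathcal Q$ as the unique minimizer such that $$\delta_{n,i}^2:=\|\Phi'(\theta_{n,i})\dot\theta_{n,i}-f(u_{n,i})\|_{\mathcal H}^2+\varepsilon_n^2\|\dot\theta_{n,i}\|_{\mathcal Q}^2\quad\text{is minimal};$$ finally $$\theta_{n+1}=\theta_n+h_n\sum_{j=1}^sb_j\dot\theta_{n,j},\qquad u_{n+1}=\Phi(\theta_{n+1}).$$ "Sufficiently differentiable" means that $f$ has enough bounded derivatives near the solution for the underlying Runge--Kutta method applied to $\dot y=f(y)$ to have local error $O(h^{p+1})$. The $O$-constants may depend on $f$ (including its Lipschitz constants and derivative bounds), $\Phi$ (bound of its second derivative), $c$, the Runge--Kutta coefficients, and $\bar t$. *)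

theory Defs
  imports "HOL-Analysis.Analysis"
begin

(* A Hilbert space is a type of class real_inner and complete_space, equipped with a scalar product
   ip that induces its norm.  Over the reals, ip x y = complex_of_real (inner x y).  A complex
   Hilbert space is of this form as well: its underlying real space carries inner x y = Re (ip x y),
   with the same norm.  Complex homogeneity of ip is not demanded, since the real case has none. *)

definition hilbert_scalar_product :: "('h::real_inner \<Rightarrow> 'h \<Rightarrow> complex) \<Rightarrow> bool" where
  "hilbert_scalar_product ip \<longleftrightarrow>
     (\<forall>x y z. ip (x + y) z = ip x z + ip y z) \<and>
     (\<forall>r x y. ip (r *\<^sub>R x) y = of_real r * ip x y) \<and>
     (\<forall>x y. ip y x = cnj (ip x y)) \<and>
     (\<forall>x. ip x x = of_real ((norm x)\<^sup>2))"

lemma hilbert_scalar_product_real: "hilbert_scalar_product (\<lambda>x y. complex_of_real (inner x y))"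
  unfolding hilbert_scalar_product_def
  by (simp add: inner_add_left power2_norm_eq_inner) (simp add: inner_commute)

definition solves_ode :: "('h::real_normed_vector \<Rightarrow> 'h) \<Rightarrow> (real \<Rightarrow> 'h) \<Rightarrow> real \<Rightarrow> bool" where
  "solves_ode f y T \<longleftrightarrow>
     (\<forall>t\<in>{0..T}. (y has_vector_derivative f (y t)) (at t within {0..T}))"

(* D k x [v1, ..., vk] is the k-th derivative of f at x applied to v1, ..., vk.  The spaces of
   k-linear maps, k = 0, 1, 2, ..., have different types, hence the encoding by lists.  The third
   and fourth conjunct say that D (Suc k) is the Frechet derivative of D k with respect to the
   operator norm of k-linear maps.  Multilinearity in all arguments follows on open sets. *)

definition has_bounded_derivatives ::
    "nat \<Rightarrow> ('a::real_normed_vector \<Rightarrow> 'b::real_normed_vector) \<Rightarrow> 'a set \<Rightarrow> bool" where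
  "has_bounded_derivatives p f U \<longleftrightarrow>
     open U \<and>
     (\<exists>D :: nat \<Rightarrow> 'a \<Rightarrow> 'a list \<Rightarrow> 'b.
        (\<forall>x\<in>U. D 0 x [] = f x) \<and>
        (\<forall>k<p. \<forall>x\<in>U. \<forall>vs. length vs = k \<longrightarrow> bounded_linear (\<lambda>v. D (Suc k) x (v # vs))) \<and>
        (\<forall>k<p. \<forall>x\<in>U. \<forall>e>0. \<exists>d>0. \<forall>z. norm (z - x) < d \<longrightarrow>
           (\<forall>vs. length vs = k \<and> (\<forall>v\<in>set vs. norm v \<le> 1) \<longrightarrow>
              norm (D k z vs - D k x vs - D (Suc k) x ((z - x) # vs)) \<le> e * norm (z - x))) \<and>
        (\<exists>M. \<forall>k\<le>p. \<forall>x\<in>U. \<forall>vs. length vs = k \<longrightarrow>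
           norm (D k x vs) \<le> M * prod_list (map norm vs)))"

definition smooth_near_solution ::
    "nat \<Rightarrow> ('h::real_normed_vector \<Rightarrow> 'h) \<Rightarrow> (real \<Rightarrow> 'h) \<Rightarrow> real \<Rightarrow> bool" where
  "smooth_near_solution p f y T \<longleftrightarrow> (\<exists>U. y ` {0..T} \<subseteq> U \<and> has_bounded_derivatives p f U)"

(* Stages are numbered from 1 to s; of the coefficients a i j only those with j < i are used. *)

function rk_slope ::
    "(nat \<Rightarrow> nat \<Rightarrow> real) \<Rightarrow> ('h::real_vector \<Rightarrow> 'h) \<Rightarrow> real \<Rightarrow> 'h \<Rightarrow> nat \<Rightarrow> 'h" where
  "rk_slope a f h y i = f (y + h *\<^sub>R (\<Sum>j\<in>{1..<i}. a i j *\<^sub>R rk_slope a f h y j))"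
  by pat_completeness auto
termination
  by (relation "Wellfounded.measure (\<lambda>(a, f, h, y, i). i)") auto

declare rk_slope.simps [simp del]

definition rk_step ::
    "(nat \<Rightarrow> nat \<Rightarrow> real) \<Rightarrow> (nat \<Rightarrow> real) \<Rightarrow> nat \<Rightarrow> ('h::real_vector \<Rightarrow> 'h) \<Rightarrow> real \<Rightarrow> 'h \<Rightarrow> 'h" where
  "rk_step a b s f h y = y + h *\<^sub>R (\<Sum>j\<in>{1..s}. b j *\<^sub>R rk_slope a f h y j)"

(* Order p: the local error is O(h^(p+1)) for every sufficiently differentiable autonomous equation
   on the space 'h.  Bounded derivatives up to order p suffice for this: in the Taylor expansions of
   the numerical and the exact solution, the slopes then have a remainder O(h^p), which enters the
   solutions with a factor h. *)

definition rk_order ::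
    "'h::real_normed_vector itself \<Rightarrow> (nat \<Rightarrow> nat \<Rightarrow> real) \<Rightarrow> (nat \<Rightarrow> real) \<Rightarrow> nat \<Rightarrow> nat \<Rightarrow> bool" where
  "rk_order _ a b s p \<longleftrightarrow>
     (\<forall>(f :: 'h \<Rightarrow> 'h) y T. 0 < T \<and> solves_ode f y T \<and> smooth_near_solution p f y T \<longrightarrow>
        (\<exists>C. \<exists>h\<^sub>0>0. \<forall>t h. 0 \<le> t \<and> 0 < h \<and> h \<le> h\<^sub>0 \<and> t + h \<le> T \<longrightarrow>
           norm (rk_step a b s f h (y t) - y (t + h)) \<le> C * h ^ (p + 1)))"

definition C2_bounded_second_derivative ::
    "real \<Rightarrow> ('q::real_normed_vector \<Rightarrow> 'h::real_normed_vector) \<Rightarrow> ('q \<Rightarrow> 'q \<Rightarrow>\<^sub>L 'h) \<Rightarrow> bool" where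
  "C2_bounded_second_derivative \<beta> \<Phi> \<Phi>' \<longleftrightarrow>
     (\<forall>\<theta>. (\<Phi> has_derivative blinfun_apply (\<Phi>' \<theta>)) (at \<theta>)) \<and>
     (\<exists>\<Phi>'' :: 'q \<Rightarrow> 'q \<Rightarrow>\<^sub>L 'q \<Rightarrow>\<^sub>L 'h.
        (\<forall>\<theta>. (\<Phi>' has_derivative blinfun_apply (\<Phi>'' \<theta>)) (at \<theta>)) \<and>
        continuous_on UNIV \<Phi>'' \<and> (\<forall>\<theta>. norm (\<Phi>'' \<theta>) \<le> \<beta>))"

definition reg_functional ::
    "('q::real_normed_vector \<Rightarrow> 'h::real_normed_vector) \<Rightarrow> ('q \<Rightarrow> 'q \<Rightarrow>\<^sub>L 'h) \<Rightarrow> ('h \<Rightarrow> 'h) \<Rightarrow>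
     real \<Rightarrow> 'q \<Rightarrow> 'q \<Rightarrow> real" where
  "reg_functional \<Phi> \<Phi>' f \<epsilon> \<theta> q =
     (norm (blinfun_apply (\<Phi>' \<theta>) q - f (\<Phi> \<theta>)))\<^sup>2 + \<epsilon>\<^sup>2 * (norm q)\<^sup>2"

(* In the following, q n i stands for the time derivative of theta in the i-th stage of step n. *)

definition reg_stage ::
    "(nat \<Rightarrow> nat \<Rightarrow> real) \<Rightarrow> (nat \<Rightarrow> real) \<Rightarrow> (nat \<Rightarrow> 'q::real_vector) \<Rightarrow> (nat \<Rightarrow> nat \<Rightarrow> 'q) \<Rightarrow>
     nat \<Rightarrow> nat \<Rightarrow> 'q" where
  "reg_stage a h \<theta> q n i = \<theta> n + h n *\<^sub>R (\<Sum>j\<in>{1..<i}. a i j *\<^sub>R q n j)"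

definition reg_defect ::
    "('q::real_normed_vector \<Rightarrow> 'h::real_normed_vector) \<Rightarrow> ('q \<Rightarrow> 'q \<Rightarrow>\<^sub>L 'h) \<Rightarrow> ('h \<Rightarrow> 'h) \<Rightarrow>
     (nat \<Rightarrow> nat \<Rightarrow> real) \<Rightarrow> (nat \<Rightarrow> real) \<Rightarrow> (nat \<Rightarrow> real) \<Rightarrow> (nat \<Rightarrow> 'q) \<Rightarrow> (nat \<Rightarrow> nat \<Rightarrow> 'q) \<Rightarrow>
     nat \<Rightarrow> nat \<Rightarrow> real" where
  "reg_defect \<Phi> \<Phi>' f a h \<epsilon> \<theta> q n i =
     sqrt (reg_functional \<Phi> \<Phi>' f (\<epsilon> n) (reg_stage a h \<theta> q n i) (q n i))"

(* For positive regularization parameters the functional is strictly convex and coercive, so that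
   is_arg_min determines q n i uniquely. *)

definition reg_rk_run ::
    "('q::real_normed_vector \<Rightarrow> 'h::real_normed_vector) \<Rightarrow> ('q \<Rightarrow> 'q \<Rightarrow>\<^sub>L 'h) \<Rightarrow> ('h \<Rightarrow> 'h) \<Rightarrow>
     (nat \<Rightarrow> nat \<Rightarrow> real) \<Rightarrow> (nat \<Rightarrow> real) \<Rightarrow> nat \<Rightarrow> nat \<Rightarrow> (nat \<Rightarrow> real) \<Rightarrow> (nat \<Rightarrow> real) \<Rightarrow>
     (nat \<Rightarrow> 'q) \<Rightarrow> (nat \<Rightarrow> nat \<Rightarrow> 'q) \<Rightarrow> bool" where
  "reg_rk_run \<Phi> \<Phi>' f a b s N h \<epsilon> \<theta> q \<longleftrightarrow>
     (\<forall>n<N.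
        (\<forall>i\<in>{1..s}. is_arg_min (reg_functional \<Phi> \<Phi>' f (\<epsilon> n) (reg_stage a h \<theta> q n i))
                       (\<lambda>_. True) (q n i)) \<and>
        \<theta> (Suc n) = \<theta> n + h n *\<^sub>R (\<Sum>j\<in>{1..s}. b j *\<^sub>R q n j))"

end

(* Along the numerical solution, the chain rule for Phi fails only by quadratic Taylor remainders,
   and the stepsize restriction bounds these by a multiple of h delta.  Hence the values
   u = Phi(theta) at the stages and at the end of a step satisfy the equations of the underlying
   Runge-Kutta method for f up to O(h delta).  Since f is globally Lipschitz, a Runge-Kutta step has
   Lipschitz constant 1 + O(h) in the initial value and in such perturbations, so the local error
   O(h delta + h^(p+1)) accumulates to O(delta + h^p) by Gronwall's inequality. *)

theory Submission
  imports Defs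
begin

section \<open>Taylor estimates for a map with bounded second derivative\<close>

lemma C2_Lipschitz_derivative:
  assumes "C2_bounded_second_derivative \<beta> \<Phi> \<Phi>'"
  shows "norm (\<Phi>' x - \<Phi>' z) \<le> \<beta> * norm (x - z)"
proof -
  obtain \<Phi>'' where D: "\<And>\<theta>. (\<Phi>' has_derivative blinfun_apply (\<Phi>'' \<theta>)) (at \<theta>)"
    and B: "\<And>\<theta>. norm (\<Phi>'' \<theta>) \<le> \<beta>"
    using assms unfolding C2_bounded_second_derivative_def by blast
  show ?thesis
    by (rule differentiable_bound[where S = UNIV and f' = "\<lambda>\<theta>. blinfun_apply (\<Phi>'' \<theta>)"])
      (use D B in \<open>auto simp: norm_blinfun.rep_eq[symmetric]\<close>)
qed

text \<open>Mean value inequality for \<open>\<Phi>\<close> minus its linear part at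
  \<open>x\<close>, whose derivative has norm at most \<open>\<beta> * norm d\<close> on the
  segment. The integral remainder would give half the constant; the factor only enters the final
  O-constant.\<close>

lemma C2_Taylor_bound:
  assumes "C2_bounded_second_derivative \<beta> \<Phi> \<Phi>'" and "0 \<le> \<beta>"
  shows "norm (\<Phi> (x + d) - \<Phi> x - blinfun_apply (\<Phi>' x) d) \<le> \<beta> * (norm d)\<^sup>2"
proof -
  define g where "g z = \<Phi> z - blinfun_apply (\<Phi>' x) z" for z
  have D: "(\<Phi> has_derivative blinfun_apply (\<Phi>' \<theta>)) (at \<theta>)" for \<theta>
    using assms unfolding C2_bounded_second_derivative_def by blast
  have g': "(g has_derivative blinfun_apply (\<Phi>' z - \<Phi>' x)) (at z within closed_segment x (x + d))" for z
    unfolding g_def minus_blinfun.rep_eq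
    by (intro has_derivative_diff has_derivative_at_withinI[OF D]
        bounded_linear_imp_has_derivative blinfun.bounded_linear_right)
  have "onorm (blinfun_apply (\<Phi>' z - \<Phi>' x)) \<le> \<beta> * norm d"
    if "z \<in> closed_segment x (x + d)" for z
  proof -
    have "norm (z - x) \<le> norm d"
      using segment_bound1[OF that] by simp
    with C2_Lipschitz_derivative[OF assms(1), of z x] assms(2)
    have "norm (\<Phi>' z - \<Phi>' x) \<le> \<beta> * norm d"
      by (meson mult_left_mono order_trans)
    then show ?thesis
      by (simp add: norm_blinfun.rep_eq)
  qed
  then have "norm (g (x + d) - g x) \<le> \<beta> * norm d * norm (x + d - x)"
    by (intro differentiable_bound[OF convex_closed_segment g']) auto
  then show ?thesis
    by (simp add: g_def blinfun.add_right power2_eq_square algebra_simps)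
qed

section \<open>Increments of \<open>\<Phi>\<close> compared with increments of the vector
  field\<close>

lemma norm_weighted_sum_le:
  fixes x :: "'i \<Rightarrow> 'v::real_normed_vector"
  assumes "\<And>j. j \<in> J \<Longrightarrow> norm (x j) \<le> M" and "(\<Sum>j\<in>J. \<bar>w j\<bar>) \<le> W" and "0 \<le> M"
  shows "norm (\<Sum>j\<in>J. w j *\<^sub>R x j) \<le> W * M"
proof -
  have "norm (\<Sum>j\<in>J. w j *\<^sub>R x j) \<le> (\<Sum>j\<in>J. \<bar>w j\<bar> * M)"
    by (rule sum_norm_le) (simp add: assms mult_left_mono)
  also have "\<dots> \<le> W * M"
    using assms by (simp add: sum_distrib_right[symmetric] mult_right_mono)
  finally show ?thesis .
qed

text \<open>The bound on \<open>h * (norm (q j))\<^sup>2\<close> is all that remains of the stepsize restriction: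
  \<open>\<epsilon> * norm q \<le> \<delta>\<close> and \<open>h * \<delta> \<le> c * \<epsilon>\<^sup>2\<close> give \<open>h * (norm q)\<^sup>2 \<le> c * \<delta>\<close>, which
  makes the quadratic Taylor remainders of size \<open>h * \<delta>\<close>, uniformly in \<open>\<epsilon>\<close>.\<close>

lemma parametrized_increment_defect:
  fixes \<Phi> :: "'q::real_normed_vector \<Rightarrow> 'h::real_normed_vector"
  assumes C2: "C2_bounded_second_derivative \<beta> \<Phi> \<Phi>'" and \<beta>: "0 \<le> \<beta>"
    and h: "0 < h" and c: "0 \<le> c" and \<delta>: "0 \<le> \<delta>" and A: "0 \<le> A"
    and w: "(\<Sum>j\<in>J. \<bar>w j\<bar>) \<le> A"
    and q: "\<And>j. j \<in> J \<Longrightarrow> h * (norm (q j))\<^sup>2 \<le> c * \<delta>"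
    and z: "\<And>j. j \<in> J \<Longrightarrow> norm (z j - \<theta>) \<le> h * (A * sqrt (c * \<delta> / h))"
    and F: "\<And>j. j \<in> J \<Longrightarrow> norm (blinfun_apply (\<Phi>' (z j)) (q j) - F j) \<le> \<delta>"
  shows "norm (\<Phi> (\<theta> + h *\<^sub>R (\<Sum>j\<in>J. w j *\<^sub>R q j)) - (\<Phi> \<theta> + h *\<^sub>R (\<Sum>j\<in>J. w j *\<^sub>R F j)))
    \<le> h * (A * (1 + 2 * \<beta> * c * A) * \<delta>)"
proof -
  \<comment> \<open>\<open>r\<close> bounds every \<open>norm (q j)\<close>. It may be large for
    small \<open>h\<close>, but it enters the final estimate only through
    \<open>h * r\<^sup>2\<close>, which equals \<open>c * \<delta>\<close>.\<close>
  define r where "r = sqrt (c * \<delta> / h)"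
  define d where "d = h *\<^sub>R (\<Sum>j\<in>J. w j *\<^sub>R q j)"
  have r0: "0 \<le> r" and hr: "h * r\<^sup>2 = c * \<delta>"
    using h c \<delta> by (auto simp: r_def)
  have qr: "norm (q j) \<le> r" if "j \<in> J" for j
    unfolding r_def using q[OF that] h by (intro real_le_rsqrt) (simp add: field_simps)
  have "norm d \<le> h * (A * r)"
    unfolding d_def using norm_weighted_sum_le[OF qr w r0] h by (simp add: mult_left_mono)
  then have "(norm d)\<^sup>2 \<le> (h * (A * r))\<^sup>2"
    by (intro power_mono) auto
  also have "\<dots> = h * A\<^sup>2 * (h * r\<^sup>2)"
    by (simp add: power2_eq_square algebra_simps)
  finally have d2: "(norm d)\<^sup>2 \<le> h * A\<^sup>2 * (c * \<delta>)"
    unfolding hr .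
  have T: "norm (\<Phi> (\<theta> + d) - \<Phi> \<theta> - blinfun_apply (\<Phi>' \<theta>) d) \<le> \<beta> * (h * A\<^sup>2 * (c * \<delta>))"
    using C2_Taylor_bound[OF C2 \<beta>, of \<theta> d] mult_left_mono[OF d2 \<beta>] by linarith
  \<comment> \<open>The approximation of \<open>F j\<close> is known at the base point
    \<open>z j\<close>, while the Taylor expansion is taken at \<open>\<theta>\<close>. Moving the
    derivative costs \<open>\<beta>\<close> times the distance \<open>h * (A * r)\<close> times
    \<open>r\<close>, again a multiple of \<open>h * r\<^sup>2\<close>.\<close>
  have "norm (blinfun_apply (\<Phi>' \<theta>) (q j) - F j) \<le> \<beta> * A * (c * \<delta>) + \<delta>" if "j \<in> J" for j
  proof -
    have "norm (\<Phi>' \<theta> - \<Phi>' (z j)) \<le> \<beta> * (h * (A * r))"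
      using C2_Lipschitz_derivative[OF C2, of \<theta> "z j"] mult_left_mono[OF z[OF that] \<beta>]
      by (simp add: r_def norm_minus_commute)
    then have "norm (blinfun_apply (\<Phi>' \<theta> - \<Phi>' (z j)) (q j)) \<le> \<beta> * (h * (A * r)) * r"
      by (intro order_trans[OF norm_blinfun] mult_mono qr that) (use \<beta> h A r0 in auto)
    also have "\<dots> = \<beta> * A * (h * r\<^sup>2)"
      by (simp add: power2_eq_square)
    finally have "norm (blinfun_apply (\<Phi>' \<theta>) (q j) - blinfun_apply (\<Phi>' (z j)) (q j))
        \<le> \<beta> * A * (c * \<delta>)"
      by (simp add: hr blinfun.diff_left)
    then show ?thesis
      using F[OF that] norm_triangle_ineq[of "blinfun_apply (\<Phi>' \<theta>) (q j) - blinfun_apply (\<Phi>' (z j)) (q j)"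
          "blinfun_apply (\<Phi>' (z j)) (q j) - F j"] by simp
  qed
  from norm_weighted_sum_le[OF this w]
  have "norm (\<Sum>j\<in>J. w j *\<^sub>R (blinfun_apply (\<Phi>' \<theta>) (q j) - F j)) \<le> A * (\<beta> * A * (c * \<delta>) + \<delta>)"
    using \<beta> A c \<delta> by simp
  moreover have "blinfun_apply (\<Phi>' \<theta>) d - h *\<^sub>R (\<Sum>j\<in>J. w j *\<^sub>R F j)
      = h *\<^sub>R (\<Sum>j\<in>J. w j *\<^sub>R (blinfun_apply (\<Phi>' \<theta>) (q j) - F j))"
    by (simp add: d_def blinfun.scaleR_right blinfun.sum_right scaleR_right_diff_distrib sum_subtractf)
  ultimately have E: "norm (blinfun_apply (\<Phi>' \<theta>) d - h *\<^sub>R (\<Sum>j\<in>J. w j *\<^sub>R F j))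
      \<le> h * (A * (\<beta> * A * (c * \<delta>) + \<delta>))"
    using h by (simp add: mult_left_mono)
  \<comment> \<open>The factor 2 joins two equal terms: the Taylor remainder and the change of base
    point.\<close>
  have "\<beta> * (h * A\<^sup>2 * (c * \<delta>)) + h * (A * (\<beta> * A * (c * \<delta>) + \<delta>))
      = h * (A * (1 + 2 * \<beta> * c * A) * \<delta>)"
    by (simp add: power2_eq_square algebra_simps)
  moreover have "norm (\<Phi> (\<theta> + d) - (\<Phi> \<theta> + h *\<^sub>R (\<Sum>j\<in>J. w j *\<^sub>R F j)))
      \<le> norm (\<Phi> (\<theta> + d) - \<Phi> \<theta> - blinfun_apply (\<Phi>' \<theta>) d)
        + norm (blinfun_apply (\<Phi>' \<theta>) d - h *\<^sub>R (\<Sum>j\<in>J. w j *\<^sub>R F j))"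
    using norm_triangle_ineq[of "\<Phi> (\<theta> + d) - \<Phi> \<theta> - blinfun_apply (\<Phi>' \<theta>) d"
        "blinfun_apply (\<Phi>' \<theta>) d - h *\<^sub>R (\<Sum>j\<in>J. w j *\<^sub>R F j)"]
    by (simp add: algebra_simps)
  ultimately show ?thesis
    using T E unfolding d_def by linarith
qed

section \<open>Stability of the explicit Runge-Kutta step\<close>

text \<open>The method is explicit, so induction on the stage number works, and each stage enlarges
  the error bound at most by the factor \<open>1 + T * A * L\<close>. Having \<open>T\<close> there
  in place of \<open>h\<close> makes the bound uniform in the stepsize.\<close>

lemma rk_slope_perturbation:
  fixes f :: "'h::real_normed_vector \<Rightarrow> 'h"
  assumes f: "L-lipschitz_on UNIV f" and h: "0 < h" "h \<le> T" and A0: "0 \<le> A"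
    and A: "\<And>i. i \<in> {1..s} \<Longrightarrow> (\<Sum>j\<in>{1..<i}. \<bar>a i j\<bar>) \<le> A"
    and U: "\<And>i. i \<in> {1..s} \<Longrightarrow>
      norm (U i - (v + h *\<^sub>R (\<Sum>j\<in>{1..<i}. a i j *\<^sub>R f (U j)))) \<le> \<rho>"
    and "0 \<le> \<rho>" and "i \<in> {1..s}"
  shows "norm (f (U i) - rk_slope a f h w i) \<le> L * (1 + T * A * L) ^ s * (norm (v - w) + \<rho>)"
proof -
  have L: "0 \<le> L"
    using f by (rule lipschitz_on_nonneg)
  define G where "G = 1 + T * A * L"
  define X where "X = norm (v - w) + \<rho>"
  have G: "1 \<le> G" and X: "0 \<le> X"
    using h A0 L \<open>0 \<le> \<rho>\<close> by (auto simp: G_def X_def)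
  have "norm (f (U i) - rk_slope a f h w i) \<le> L * G ^ i * X"
    using \<open>i \<in> {1..s}\<close>
  proof (induction i rule: less_induct)
    case (less i)
    \<comment> \<open>All stages before \<open>i\<close> have index at most \<open>k\<close> and so
      share the bound with \<open>G ^ k\<close>. The recursion closes because
      \<open>G ^ k + T * A * L * G ^ k = G ^ Suc k\<close>.\<close>
    then obtain k where k: "i = Suc k"
      by (cases i) auto
    define e where "e j = f (U j) - rk_slope a f h w j" for j
    have e: "norm (e j) \<le> L * G ^ k * X" if "j \<in> {1..<i}" for j
    proof -
      have "norm (e j) \<le> L * G ^ j * X"
        unfolding e_def using that less.prems by (intro less.IH) auto
      also have "\<dots> \<le> L * G ^ k * X"
        using that k G X L by (intro mult_right_mono mult_left_mono power_increasing) auto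
      finally show ?thesis .
    qed
    have se: "norm (\<Sum>j\<in>{1..<i}. a i j *\<^sub>R e j) \<le> A * (L * G ^ k * X)"
      by (rule norm_weighted_sum_le[OF e A[OF less.prems]]) (use L G X in auto)
    have "norm (h *\<^sub>R (\<Sum>j\<in>{1..<i}. a i j *\<^sub>R e j)) = h * norm (\<Sum>j\<in>{1..<i}. a i j *\<^sub>R e j)"
      using h by simp
    also have "\<dots> \<le> T * (A * (L * G ^ k * X))"
      using h se by (intro mult_mono) auto
    finally have s2: "norm (h *\<^sub>R (\<Sum>j\<in>{1..<i}. a i j *\<^sub>R e j)) \<le> T * (A * (L * G ^ k * X))" .
    define V where "V = w + h *\<^sub>R (\<Sum>j\<in>{1..<i}. a i j *\<^sub>R rk_slope a f h w j)"
    define R where "R = U i - (v + h *\<^sub>R (\<Sum>j\<in>{1..<i}. a i j *\<^sub>R f (U j)))"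
    have "U i - V = (v - w) + R + h *\<^sub>R (\<Sum>j\<in>{1..<i}. a i j *\<^sub>R e j)"
      by (simp add: V_def R_def e_def scaleR_right_diff_distrib sum_subtractf)
    then have "norm (U i - V) \<le> norm (v - w) + norm R + norm (h *\<^sub>R (\<Sum>j\<in>{1..<i}. a i j *\<^sub>R e j))"
      using norm_triangle_le[OF add_mono[OF norm_triangle_ineq order_refl]] by metis
    also have "\<dots> \<le> X + T * (A * (L * G ^ k * X))"
      using U[OF less.prems] s2 by (simp add: X_def R_def)
    also have "\<dots> \<le> G ^ k * X + T * (A * (L * G ^ k * X))"
      using mult_right_mono[OF one_le_power[OF G, of k] X] by simp
    also have "\<dots> = G ^ i * X"
      by (simp add: k G_def algebra_simps)
    finally have "L * norm (U i - V) \<le> L * (G ^ i * X)"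
      using L by (rule mult_left_mono)
    moreover have "norm (f (U i) - f V) \<le> L * norm (U i - V)"
      using lipschitz_on_normD[OF f] by simp
    moreover have "rk_slope a f h w i = f V"
      by (simp add: V_def rk_slope.simps[of a f h w i])
    ultimately show ?case
      by (simp add: mult.assoc)
  qed
  also have "\<dots> \<le> L * G ^ s * X"
    using \<open>i \<in> {1..s}\<close> G X L by (intro mult_right_mono mult_left_mono power_increasing) auto
  finally show ?thesis
    by (simp add: G_def X_def)
qed

text \<open>For \<open>h \<le> T\<close>, a Lipschitz constant of the weighted sum of slopes as a
  function of the initial value, where \<open>A\<close> bounds the absolute coefficient sums and
  \<open>L\<close> is the Lipschitz constant of the vector field.\<close>

definition rk_stability_constant :: "real \<Rightarrow> real \<Rightarrow> real \<Rightarrow> nat \<Rightarrow> real" where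
  "rk_stability_constant A L T s = A * L * (1 + T * A * L) ^ s"

text \<open>The residuals keep a factor \<open>h\<close> so that they can be summed over all steps.
  Those of the stages reach the result only through the slopes, which brings a second factor
  \<open>h\<close>; estimating it by \<open>T\<close> gives \<open>1 + K * T\<close>.\<close>

lemma rk_step_perturbation:
  fixes f :: "'h::real_normed_vector \<Rightarrow> 'h" and A L T :: real and s :: nat
  defines "K \<equiv> rk_stability_constant A L T s"
  assumes f: "L-lipschitz_on UNIV f" and h: "0 < h" "h \<le> T" and A0: "0 \<le> A"
    and A: "\<And>i. i \<in> {1..s} \<Longrightarrow> (\<Sum>j\<in>{1..<i}. \<bar>a i j\<bar>) \<le> A"
    and b: "(\<Sum>j\<in>{1..s}. \<bar>b j\<bar>) \<le> A"
    and U: "\<And>i. i \<in> {1..s} \<Longrightarrow>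
      norm (U i - (v + h *\<^sub>R (\<Sum>j\<in>{1..<i}. a i j *\<^sub>R f (U j)))) \<le> h * \<eta>"
    and u: "norm (u - (v + h *\<^sub>R (\<Sum>j\<in>{1..s}. b j *\<^sub>R f (U j)))) \<le> h * \<eta>"
    and \<eta>: "0 \<le> \<eta>"
  shows "norm (u - rk_step a b s f h w) \<le> (1 + K * h) * norm (v - w) + h * ((1 + K * T) * \<eta>)"
proof -
  have L: "0 \<le> L"
    using f by (rule lipschitz_on_nonneg)
  have K: "0 \<le> K"
    using L A0 h by (simp add: K_def rk_stability_constant_def)
  define e where "e j = f (U j) - rk_slope a f h w j" for j
  have "norm (e j) \<le> L * (1 + T * A * L) ^ s * (norm (v - w) + h * \<eta>)" if "j \<in> {1..s}" for j
    unfolding e_def using h \<eta> that by (intro rk_slope_perturbation[OF f h A0 A U]) auto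
  from norm_weighted_sum_le[OF this b]
  have "norm (\<Sum>j\<in>{1..s}. b j *\<^sub>R e j) \<le> K * (norm (v - w) + h * \<eta>)"
    using h \<eta> A0 L by (simp add: K_def rk_stability_constant_def mult.assoc)
  then have s: "norm (h *\<^sub>R (\<Sum>j\<in>{1..s}. b j *\<^sub>R e j)) \<le> h * (K * (norm (v - w) + h * \<eta>))"
    using h by (simp add: mult_left_mono)
  define R where "R = u - (v + h *\<^sub>R (\<Sum>j\<in>{1..s}. b j *\<^sub>R f (U j)))"
  have "u - rk_step a b s f h w = (v - w) + R + h *\<^sub>R (\<Sum>j\<in>{1..s}. b j *\<^sub>R e j)"
    by (simp add: R_def e_def rk_step_def scaleR_right_diff_distrib sum_subtractf)
  then have "norm (u - rk_step a b s f h w)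
      \<le> norm (v - w) + norm R + norm (h *\<^sub>R (\<Sum>j\<in>{1..s}. b j *\<^sub>R e j))"
    using norm_triangle_le[OF add_mono[OF norm_triangle_ineq order_refl]] by metis
  also have "\<dots> \<le> norm (v - w) + h * \<eta> + h * (K * (norm (v - w) + h * \<eta>))"
    using s u by (simp add: R_def)
  also have "\<dots> = (1 + K * h) * norm (v - w) + h * \<eta> + h * (K * \<eta>) * h"
    by (simp add: algebra_simps)
  also have "\<dots> \<le> (1 + K * h) * norm (v - w) + h * \<eta> + h * (K * \<eta>) * T"
    using h K \<eta> by (intro add_left_mono mult_left_mono) auto
  finally show ?thesis
    by (simp add: algebra_simps)
qed

section \<open>Local error for all stepsizes up to the length of the interval\<close>

text \<open>\<open>rk_order\<close> covers only stepsizes up to some \<open>h\<^sub>0\<close>. For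
  longer steps the error is at most a constant, since \<open>y\<close> and \<open>f\<close> along
  \<open>y\<close> are bounded on the compact interval, and above \<open>h\<^sub>0\<close> a
  constant is at most a multiple of \<open>h ^ (p + 1)\<close>.\<close>

lemma rk_local_error:
  fixes f :: "'h::real_normed_vector \<Rightarrow> 'h"
  assumes order: "rk_order TYPE('h) a b s p" and f: "L-lipschitz_on UNIV f"
    and T: "0 < T" and y: "solves_ode f y T" "smooth_near_solution p f y T" and A0: "0 \<le> A"
    and A: "\<And>i. i \<in> {1..s} \<Longrightarrow> (\<Sum>j\<in>{1..<i}. \<bar>a i j\<bar>) \<le> A"
    and b: "(\<Sum>j\<in>{1..s}. \<bar>b j\<bar>) \<le> A"
  obtains C where "0 \<le> C" "\<And>t h. 0 \<le> t \<Longrightarrow> 0 < h \<Longrightarrow> t + h \<le> T \<Longrightarrow>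
      norm (rk_step a b s f h (y t) - y (t + h)) \<le> C * h ^ (p + 1)"
proof -
  obtain C\<^sub>1 h\<^sub>0 where h0: "0 < h\<^sub>0"
    and C1: "\<And>t h. 0 \<le> t \<Longrightarrow> 0 < h \<Longrightarrow> h \<le> h\<^sub>0 \<Longrightarrow> t + h \<le> T \<Longrightarrow>
           norm (rk_step a b s f h (y t) - y (t + h)) \<le> C\<^sub>1 * h ^ (p + 1)"
    using order T y unfolding rk_order_def by meson
  have L: "0 \<le> L"
    using f by (rule lipschitz_on_nonneg)
  define K where "K = rk_stability_constant A L T s"
  have K: "0 \<le> K"
    using L A0 T by (simp add: K_def rk_stability_constant_def)
  have cy: "continuous_on {0..T} y"
    using y(1) unfolding solves_ode_def continuous_on_eq_continuous_within
    by (blast intro: has_vector_derivative_continuous)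
  then have "bounded (y ` {0..T})"
    by (intro compact_imp_bounded compact_continuous_image) auto
  then obtain M where M: "\<And>t. t \<in> {0..T} \<Longrightarrow> norm (y t) \<le> M"
    unfolding bounded_iff by blast
  have "continuous_on {0..T} (\<lambda>t. f (y t))"
    using lipschitz_on_continuous_on[OF f] cy by (rule continuous_on_compose2) auto
  then have "bounded ((\<lambda>t. f (y t)) ` {0..T})"
    by (intro compact_imp_bounded compact_continuous_image) auto
  then obtain B where B: "\<And>t. t \<in> {0..T} \<Longrightarrow> norm (f (y t)) \<le> B"
    unfolding bounded_iff by blast
  have M0: "0 \<le> M" and B0: "0 \<le> B"
    using M[of 0] B[of 0] norm_ge_zero T order_trans by (metis atLeastAtMost_iff less_imp_le order_refl)+
  \<comment> \<open>The first summand bounds the increment of a Runge-Kutta step from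
    \<open>y t\<close>, the second the variation of \<open>y\<close>.\<close>
  define C\<^sub>2 where "C\<^sub>2 = T * ((1 + K * T) * (A * B)) + 2 * M"
  have C20: "0 \<le> C\<^sub>2"
    using T K A0 B0 M0 by (simp add: C\<^sub>2_def)
  define C where "C = \<bar>C\<^sub>1\<bar> + C\<^sub>2 / h\<^sub>0 ^ (p + 1)"
  have "norm (rk_step a b s f h (y t) - y (t + h)) \<le> C * h ^ (p + 1)"
    if t: "0 \<le> t" "0 < h" "t + h \<le> T" for t h
  proof (cases "h \<le> h\<^sub>0")
    case True
    have "norm (rk_step a b s f h (y t) - y (t + h)) \<le> C\<^sub>1 * h ^ (p + 1)"
      using C1 t True by blast
    also have "\<dots> \<le> C * h ^ (p + 1)"
      using t C20 h0 by (intro mult_right_mono) (auto simp: C_def add_increasing2)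
    finally show ?thesis .
  next
    case False
    have hT: "h \<le> T"
      using t by simp
    have fy: "norm (f (y t)) \<le> B"
      using t by (intro B) auto
    have W: "norm (y t - (y t + h *\<^sub>R (\<Sum>j\<in>J. w j *\<^sub>R f (y t)))) \<le> h * (A * B)"
      if "(\<Sum>j\<in>J. \<bar>w j\<bar>) \<le> A" for J :: "nat set" and w
      using norm_weighted_sum_le[OF fy that B0] t by (simp add: mult_left_mono)
    \<comment> \<open>The constant stages \<open>y t\<close> are a perturbation of the Runge--Kutta stages.\<close>
    have "norm (y t - rk_step a b s f h (y t))
        \<le> (1 + K * h) * norm (y t - y t) + h * ((1 + K * T) * (A * B))"
      unfolding K_def
      by (rule rk_step_perturbation[OF f t(2) hT A0 A b, where U = "\<lambda>_. y t"])
        (use W[OF A] W[OF b] A0 B0 in auto)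
    also have "\<dots> \<le> T * ((1 + K * T) * (A * B))"
      using hT K T A0 B0 by (simp add: mult_right_mono)
    finally have "norm (rk_step a b s f h (y t) - y t) \<le> T * ((1 + K * T) * (A * B))"
      by (simp add: norm_minus_commute)
    moreover have "norm (y t - y (t + h)) \<le> M + M"
      using t by (intro norm_triangle_le_diff add_mono M) auto
    ultimately have "norm (rk_step a b s f h (y t) - y (t + h)) \<le> C\<^sub>2 * 1"
      using norm_triangle_ineq[of "rk_step a b s f h (y t) - y t" "y t - y (t + h)"]
      by (simp add: C\<^sub>2_def)
    also have "\<dots> \<le> C\<^sub>2 * (h / h\<^sub>0) ^ (p + 1)"
      using False h0 C20 by (intro mult_left_mono one_le_power) auto
    also have "\<dots> = C\<^sub>2 / h\<^sub>0 ^ (p + 1) * h ^ (p + 1)"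
      by (simp add: power_divide)
    also have "\<dots> \<le> C * h ^ (p + 1)"
      using t by (intro mult_right_mono) (auto simp: C_def)
    finally show ?thesis .
  qed
  moreover have "0 \<le> C"
    using C20 h0 by (simp add: C_def)
  ultimately show thesis
    by (rule that[rotated])
qed

section \<open>Accumulation of errors over variable steps\<close>

text \<open>The exponents add up along the induction because
  \<open>1 + K * h n \<le> exp (K * h n)\<close>, and the new term may be multiplied by an
  exponential that is at least 1. This form of the bound avoids a division by \<open>K\<close>,
  which may be 0.\<close>

lemma discrete_Gronwall:
  fixes e h :: "nat \<Rightarrow> real"
  assumes "e 0 \<le> 0" and K: "0 \<le> K" and g: "0 \<le> g" and h: "\<And>n. n < N \<Longrightarrow> 0 \<le> h n"
    and step: "\<And>n. n < N \<Longrightarrow> e (Suc n) \<le> (1 + K * h n) * e n + h n * g"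
    and "n \<le> N"
  shows "e n \<le> (\<Sum>k<n. h k) * g * exp (K * (\<Sum>k<n. h k))"
  using \<open>n \<le> N\<close>
proof (induction n)
  case 0
  then show ?case
    using assms(1) by simp
next
  case (Suc n)
  define t where "t = (\<Sum>k<n. h k)"
  have hn: "0 \<le> h n" and t: "0 \<le> t"
    using h Suc.prems by (auto simp: t_def intro!: sum_nonneg)
  have IH: "e n \<le> t * g * exp (K * t)"
    using Suc by (simp add: t_def)
  have "e (Suc n) \<le> (1 + K * h n) * e n + h n * g"
    using step Suc.prems by simp
  also have "\<dots> \<le> exp (K * h n) * (t * g * exp (K * t)) + h n * g * exp (K * (t + h n))"
  proof (rule add_mono)
    have "(1 + K * h n) * e n \<le> (1 + K * h n) * (t * g * exp (K * t))"
      using IH K hn by (intro mult_left_mono) auto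
    also have "\<dots> \<le> exp (K * h n) * (t * g * exp (K * t))"
      using t g by (intro mult_right_mono exp_ge_add_one_self) auto
    finally show "(1 + K * h n) * e n \<le> exp (K * h n) * (t * g * exp (K * t))" .
    have "1 \<le> exp (K * (t + h n))"
      using K t hn by simp
    then show "h n * g \<le> h n * g * exp (K * (t + h n))"
      using mult_left_mono[of 1 "exp (K * (t + h n))" "h n * g"] hn g by simp
  qed
  also have "\<dots> = (t + h n) * g * exp (K * (t + h n))"
    by (simp add: exp_add algebra_simps)
  finally show ?case
    by (simp add: t_def)
qed

section \<open>Defect of one regularized step\<close>

lemma reg_defect_bounds:
  assumes "0 < \<epsilon> n" and "0 < h n"
    and "h n * reg_defect \<Phi> \<Phi>' f a h \<epsilon> \<theta> q n i \<le> c * (\<epsilon> n)\<^sup>2"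
  shows "norm (blinfun_apply (\<Phi>' (reg_stage a h \<theta> q n i)) (q n i) - f (\<Phi> (reg_stage a h \<theta> q n i)))
      \<le> reg_defect \<Phi> \<Phi>' f a h \<epsilon> \<theta> q n i" (is "?R \<le> ?d")
    and "h n * (norm (q n i))\<^sup>2 \<le> c * reg_defect \<Phi> \<Phi>' f a h \<epsilon> \<theta> q n i"
proof -
  have d: "?d = sqrt (?R\<^sup>2 + (\<epsilon> n * norm (q n i))\<^sup>2)"
    by (simp add: reg_defect_def reg_functional_def power_mult_distrib)
  show "?R \<le> ?d"
    unfolding d by (intro real_le_rsqrt) auto
  have d2: "(\<epsilon> n)\<^sup>2 * (norm (q n i))\<^sup>2 \<le> ?d\<^sup>2" and d0: "0 \<le> ?d"
    unfolding d by (simp_all add: power_mult_distrib)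
  \<comment> \<open>Of the two factors \<open>?d\<close>, one is traded with \<open>h n\<close> for
    \<open>c * (\<epsilon> n)\<^sup>2\<close> by the stepsize restriction; then the positive
    \<open>(\<epsilon> n)\<^sup>2\<close> cancels.\<close>
  have "(\<epsilon> n)\<^sup>2 * (h n * (norm (q n i))\<^sup>2) \<le> h n * ?d\<^sup>2"
    using mult_left_mono[OF d2, of "h n"] assms(2) by (simp add: mult.left_commute)
  also have "\<dots> = (h n * ?d) * ?d"
    by (simp add: power2_eq_square)
  also have "\<dots> \<le> c * (\<epsilon> n)\<^sup>2 * ?d"
    using assms(3) d0 by (rule mult_right_mono)
  also have "\<dots> = (\<epsilon> n)\<^sup>2 * (c * ?d)"
    by simp
  finally show "h n * (norm (q n i))\<^sup>2 \<le> c * ?d"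
    using assms(1) by simp
qed

text \<open>General \<open>J\<close> and \<open>w\<close> let one estimate serve both the stages
  (\<open>{1..<i}\<close> and \<open>a i\<close>) and the end of the step (\<open>{1..s}\<close> and
  \<open>b\<close>).\<close>

lemma reg_rk_step_defect:
  fixes \<Phi> :: "'q::real_normed_vector \<Rightarrow> 'h::real_normed_vector"
  assumes C2: "C2_bounded_second_derivative \<beta> \<Phi> \<Phi>'" and \<beta>: "0 \<le> \<beta>"
    and h: "0 < h n" and \<epsilon>: "0 < \<epsilon> n" and c: "0 \<le> c" and \<delta>0: "0 \<le> \<delta>" and A0: "0 \<le> A"
    and A: "\<And>i. i \<in> {1..s} \<Longrightarrow> (\<Sum>j\<in>{1..<i}. \<bar>a i j\<bar>) \<le> A"
    and restr: "\<And>i. i \<in> {1..s} \<Longrightarrow> h n * reg_defect \<Phi> \<Phi>' f a h \<epsilon> \<theta> q n i \<le> c * (\<epsilon> n)\<^sup>2"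
    and \<delta>: "\<And>i. i \<in> {1..s} \<Longrightarrow> reg_defect \<Phi> \<Phi>' f a h \<epsilon> \<theta> q n i \<le> \<delta>"
    and J: "J \<subseteq> {1..s}" and w: "(\<Sum>j\<in>J. \<bar>w j\<bar>) \<le> A"
  shows "norm (\<Phi> (\<theta> n + h n *\<^sub>R (\<Sum>j\<in>J. w j *\<^sub>R q n j))
      - (\<Phi> (\<theta> n) + h n *\<^sub>R (\<Sum>j\<in>J. w j *\<^sub>R f (\<Phi> (reg_stage a h \<theta> q n j)))))
    \<le> h n * (A * (1 + 2 * \<beta> * c * A) * \<delta>)"
proof -
  have q: "h n * (norm (q n i))\<^sup>2 \<le> c * \<delta>" if "i \<in> {1..s}" for i
    using reg_defect_bounds(2)[OF \<epsilon> h restr[OF that]] mult_left_mono[OF \<delta>[OF that] c] by linarith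
  have r: "norm (q n i) \<le> sqrt (c * \<delta> / h n)" if "i \<in> {1..s}" for i
    using q[OF that] h by (intro real_le_rsqrt) (simp add: field_simps)
  show ?thesis
  proof (rule parametrized_increment_defect[OF C2 \<beta> h c \<delta>0 A0 w])
    fix j assume "j \<in> J"
    then have j: "j \<in> {1..s}"
      using J by auto
    show "h n * (norm (q n j))\<^sup>2 \<le> c * \<delta>"
      using q[OF j] .
    show "norm (blinfun_apply (\<Phi>' (reg_stage a h \<theta> q n j)) (q n j) - f (\<Phi> (reg_stage a h \<theta> q n j))) \<le> \<delta>"
      using reg_defect_bounds(1)[OF \<epsilon> h restr[OF j]] \<delta>[OF j] by linarith
    have "norm (\<Sum>k\<in>{1..<j}. a j k *\<^sub>R q n k) \<le> A * sqrt (c * \<delta> / h n)"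
      using j by (intro norm_weighted_sum_le A r) (use c \<delta>0 h in auto)
    then show "norm (reg_stage a h \<theta> q n j - \<theta> n) \<le> h n * (A * sqrt (c * \<delta> / h n))"
      using h by (simp add: reg_stage_def mult_left_mono)
  qed
qed

section \<open>Global convergence\<close>

text \<open>Uniformity of the O-constant is expressed by the order of quantifiers: \<open>C\<close>
  precedes the grid, the regularization parameters and \<open>\<Phi>\<close>, which influences it
  only through \<open>\<beta>\<close>.\<close>

theorem theorem5p1:
  fixes ip :: "'h::{real_inner, complete_space} \<Rightarrow> 'h \<Rightarrow> complex"
    and f :: "'h \<Rightarrow> 'h" and y :: "real \<Rightarrow> 'h"
    and L l T c \<beta> :: real
    and a :: "nat \<Rightarrow> nat \<Rightarrow> real" and b :: "nat \<Rightarrow> real" and s p :: nat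
  assumes "hilbert_scalar_product ip"
    and "\<exists>B :: 'q::real_inner set. finite B \<and> span B = UNIV"
    and "0 < s" and "rk_order TYPE('h) a b s p"
    and "L-lipschitz_on UNIV f"
    and "\<And>v w. Re (ip (v - w) (f v - f w)) \<le> l * (norm (v - w))\<^sup>2"
    and "0 < T" and "solves_ode f y T" and "smooth_near_solution p f y T"
    and "0 < c"
  shows "\<exists>C. \<forall>(\<Phi> :: 'q \<Rightarrow> 'h) \<Phi>' N h \<epsilon> \<theta> q.
           C2_bounded_second_derivative \<beta> \<Phi> \<Phi>' \<and>
           (\<forall>n<N. 0 < h n \<and> 0 < \<epsilon> n) \<and> (\<Sum>k<N. h k) = T \<and>
           \<Phi> (\<theta> 0) = y 0 \<and>
           reg_rk_run \<Phi> \<Phi>' f a b s N h \<epsilon> \<theta> q \<and>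
           (\<forall>n<N. \<forall>i\<in>{1..s}. h n * reg_defect \<Phi> \<Phi>' f a h \<epsilon> \<theta> q n i \<le> c * (\<epsilon> n)\<^sup>2) \<longrightarrow>
           (\<forall>n\<le>N. norm (\<Phi> (\<theta> n) - y (\<Sum>k<n. h k)) \<le>
              C * (Max {reg_defect \<Phi> \<Phi>' f a h \<epsilon> \<theta> q m i | m i. m < N \<and> i \<in> {1..s}}
                   + (Max (h ` {..<N})) ^ p))"
proof (cases "0 \<le> \<beta>")
  case False
  \<comment> \<open>A norm cannot be at most a negative \<open>\<beta>\<close>, so the claim is
    vacuous here.\<close>
  then have "\<not> C2_bounded_second_derivative \<beta> \<Phi> \<Phi>'" for \<Phi> :: "'q \<Rightarrow> 'h" and \<Phi>'
    unfolding C2_bounded_second_derivative_def by (metis norm_ge_zero order_trans)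
  then show ?thesis
    by blast
next
  case \<beta>: True
  note f = \<open>L-lipschitz_on UNIV f\<close>
  \<comment> \<open>A single constant dominates the absolute sums of the weights of every stage and
    of the final update.\<close>
  define A where "A = (\<Sum>i\<in>{1..s}. \<Sum>j\<in>{1..s}. \<bar>a i j\<bar>) + (\<Sum>j\<in>{1..s}. \<bar>b j\<bar>)"
  have a0: "0 \<le> (\<Sum>i\<in>{1..s}. \<Sum>j\<in>{1..s}. \<bar>a i j\<bar>)" and b0: "0 \<le> (\<Sum>j\<in>{1..s}. \<bar>b j\<bar>)"
    by (auto intro!: sum_nonneg)
  have A0: "0 \<le> A" and b: "(\<Sum>j\<in>{1..s}. \<bar>b j\<bar>) \<le> A"
    using a0 b0 by (auto simp: A_def)
  have A: "(\<Sum>j\<in>{1..<i}. \<bar>a i j\<bar>) \<le> A" if i: "i \<in> {1..s}" for i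
  proof -
    have "(\<Sum>j\<in>{1..<i}. \<bar>a i j\<bar>) \<le> (\<Sum>j\<in>{1..s}. \<bar>a i j\<bar>)"
      using i by (intro sum_mono2) auto
    also have "\<dots> \<le> (\<Sum>i\<in>{1..s}. \<Sum>j\<in>{1..s}. \<bar>a i j\<bar>)"
      using i by (intro member_le_sum) (auto intro!: sum_nonneg)
    also have "\<dots> \<le> A"
      using b0 by (simp add: A_def)
    finally show ?thesis .
  qed
  obtain C\<^sub>1 where C1: "0 \<le> C\<^sub>1"
    and local: "\<And>t h. 0 \<le> t \<Longrightarrow> 0 < h \<Longrightarrow> t + h \<le> T \<Longrightarrow>
      norm (rk_step a b s f h (y t) - y (t + h)) \<le> C\<^sub>1 * h ^ (p + 1)"
    using rk_local_error[OF \<open>rk_order TYPE('h) a b s p\<close> f \<open>0 < T\<close> \<open>solves_ode f y T\<close>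
        \<open>smooth_near_solution p f y T\<close> A0 A b] by blast
  define K where "K = rk_stability_constant A L T s"
  have K: "0 \<le> K"
    using lipschitz_on_nonneg[OF f] A0 \<open>0 < T\<close> by (simp add: K_def rk_stability_constant_def)
  define D where "D = A * (1 + 2 * \<beta> * c * A)"
  have D: "0 \<le> D"
    using A0 \<beta> \<open>0 < c\<close> by (simp add: D_def)
  \<comment> \<open>The first summand stems from the perturbation of the Runge-Kutta equations, the
    second from the local error.\<close>
  define C\<^sub>2 where "C\<^sub>2 = (1 + K * T) * D + C\<^sub>1"
  have C2_0: "0 \<le> C\<^sub>2"
    using K D C1 \<open>0 < T\<close> by (simp add: C\<^sub>2_def)
  show ?thesis
  \<comment> \<open>The witness is the Gronwall bound at time \<open>T\<close>, without the factor
    \<open>\<delta> + H ^ p\<close>.\<close>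
  proof (rule exI[where x = "T * C\<^sub>2 * exp (K * T)"], intro allI impI, elim conjE)
    fix \<Phi> :: "'q \<Rightarrow> 'h" and \<Phi>' N h \<epsilon> \<theta> q n
    assume C2: "C2_bounded_second_derivative \<beta> \<Phi> \<Phi>'"
      and pos: "\<forall>n<N. 0 < h n \<and> 0 < \<epsilon> n" and sum: "(\<Sum>k<N. h k) = T"
      and init: "\<Phi> (\<theta> 0) = y 0" and run: "reg_rk_run \<Phi> \<Phi>' f a b s N h \<epsilon> \<theta> q"
      and restr: "\<forall>n<N. \<forall>i\<in>{1..s}. h n * reg_defect \<Phi> \<Phi>' f a h \<epsilon> \<theta> q n i \<le> c * (\<epsilon> n)\<^sup>2"
      and n: "n \<le> N"
    let ?d = "reg_defect \<Phi> \<Phi>' f a h \<epsilon> \<theta> q"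
    let ?S = "{?d m i | m i. m < N \<and> i \<in> {1..s}}"
    define \<delta> where "\<delta> = Max ?S"
    define H where "H = Max (h ` {..<N})"
    define t where "t n = (\<Sum>k<n. h k)" for n
    define e where "e n = norm (\<Phi> (\<theta> n) - y (t n))" for n
    \<comment> \<open>Finiteness is what makes \<open>Max ?S\<close> an upper bound of the
      defects.\<close>
    have "?S \<subseteq> (\<lambda>(m, i). ?d m i) ` ({..<N} \<times> {1..s})"
      by auto
    then have "finite ?S"
      by (rule finite_subset) auto
    then have \<delta>: "?d m i \<le> \<delta>" if "m < N" "i \<in> {1..s}" for m i
      unfolding \<delta>_def using that by (intro Max_ge) blast+
    have H: "h m \<le> H" if "m < N" for m
      unfolding H_def using that by (intro Max_ge) auto
    have N: "0 < N"
      using sum \<open>0 < T\<close> by (cases N) auto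
    \<comment> \<open>The set of defects is nonempty since \<open>N\<close> and \<open>s\<close> are
      positive; any member shows that its maximum is nonnegative.\<close>
    have "0 \<le> ?d 0 1"
      by (simp add: reg_defect_def reg_functional_def)
    then have \<delta>0: "0 \<le> \<delta>"
      using \<delta>[OF N, of 1] \<open>0 < s\<close> by simp
    have H0: "0 \<le> H"
      using H[OF N] pos N by force
    have tT: "t m \<le> T" if "m \<le> N" for m
      unfolding t_def sum[symmetric] using that pos by (intro sum_mono2) (auto simp: less_imp_le)
    have t0: "0 \<le> t m" if "m \<le> N" for m
      unfolding t_def using that pos by (intro sum_nonneg) (auto simp: less_imp_le)
    have tS: "t (Suc m) = t m + h m" for m
      by (simp add: t_def)
    \<comment> \<open>The Runge-Kutta step started at the exact value \<open>y (t m)\<close> is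
      inserted: stability compares it with the numerical result, the local error with
      \<open>y (t (Suc m))\<close>.\<close>
    have step: "e (Suc m) \<le> (1 + K * h m) * e m + h m * (C\<^sub>2 * (\<delta> + H ^ p))" if m: "m < N" for m
    proof -
      have hm: "0 < h m" and \<epsilon>: "0 < \<epsilon> m"
        using pos m by auto
      have th: "t m + h m \<le> T"
        using tT[of "Suc m"] m by (simp add: tS)
      then have hT: "h m \<le> T"
        using t0[of m] m by simp
      have defect: "norm (\<Phi> (\<theta> m + h m *\<^sub>R (\<Sum>j\<in>J. w j *\<^sub>R q m j))
          - (\<Phi> (\<theta> m) + h m *\<^sub>R (\<Sum>j\<in>J. w j *\<^sub>R f (\<Phi> (reg_stage a h \<theta> q m j)))))
          \<le> h m * (D * \<delta>)" if "J \<subseteq> {1..s}" "(\<Sum>j\<in>J. \<bar>w j\<bar>) \<le> A" for J w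
        unfolding D_def
        by (rule reg_rk_step_defect[where s = s and \<epsilon> = \<epsilon>])
          (use C2 \<beta> hm \<epsilon> \<open>0 < c\<close> \<delta>0 A0 A restr \<delta> m that in auto)
      have "norm (\<Phi> (\<theta> (Suc m)) - rk_step a b s f (h m) (y (t m)))
          \<le> (1 + K * h m) * e m + h m * ((1 + K * T) * (D * \<delta>))"
        unfolding K_def e_def
      proof (rule rk_step_perturbation[OF f hm hT A0 A b,
            where U = "\<lambda>i. \<Phi> (reg_stage a h \<theta> q m i)"])
        show "norm (\<Phi> (reg_stage a h \<theta> q m i) - (\<Phi> (\<theta> m)
            + h m *\<^sub>R (\<Sum>j\<in>{1..<i}. a i j *\<^sub>R f (\<Phi> (reg_stage a h \<theta> q m j))))) \<le> h m * (D * \<delta>)"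
          if "i \<in> {1..s}" for i
          unfolding reg_stage_def[of a h \<theta> q m i] using that by (intro defect A) auto
        have "\<theta> (Suc m) = \<theta> m + h m *\<^sub>R (\<Sum>j\<in>{1..s}. b j *\<^sub>R q m j)"
          using run m by (simp add: reg_rk_run_def)
        then show "norm (\<Phi> (\<theta> (Suc m)) - (\<Phi> (\<theta> m)
            + h m *\<^sub>R (\<Sum>j\<in>{1..s}. b j *\<^sub>R f (\<Phi> (reg_stage a h \<theta> q m j))))) \<le> h m * (D * \<delta>)"
          using defect[of "{1..s}" b] b by simp
      qed (use D \<delta>0 in auto)
      moreover have "norm (rk_step a b s f (h m) (y (t m)) - y (t (Suc m))) \<le> h m * (C\<^sub>1 * H ^ p)"
      proof -
        \<comment> \<open>Of the \<open>p + 1\<close> powers of \<open>h m\<close>, one is kept for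
          the summation over the steps; the others are estimated by \<open>H\<close>.\<close>
        have "C\<^sub>1 * h m ^ p \<le> C\<^sub>1 * H ^ p"
          using C1 hm H[OF m] by (intro mult_left_mono power_mono) auto
        from mult_left_mono[OF this, of "h m"] local[OF t0 hm th] m hm
        show ?thesis
          by (simp add: tS mult.left_commute)
      qed
      ultimately have "e (Suc m) \<le> (1 + K * h m) * e m
          + h m * ((1 + K * T) * D * \<delta> + C\<^sub>1 * H ^ p)"
        unfolding e_def[of "Suc m"]
        using norm_triangle_ineq[of "\<Phi> (\<theta> (Suc m)) - rk_step a b s f (h m) (y (t m))"
            "rk_step a b s f (h m) (y (t m)) - y (t (Suc m))"]
        by (simp add: algebra_simps)
      also have "(1 + K * T) * D * \<delta> + C\<^sub>1 * H ^ p \<le> C\<^sub>2 * \<delta> + C\<^sub>2 * H ^ p"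
        using K D C1 \<open>0 < T\<close> \<delta>0 H0 by (intro add_mono mult_right_mono) (auto simp: C\<^sub>2_def)
      finally show ?thesis
        using hm by (simp add: distrib_left mult_left_mono)
    qed
    have "e n \<le> t n * (C\<^sub>2 * (\<delta> + H ^ p)) * exp (K * t n)"
      unfolding t_def
      by (rule discrete_Gronwall[where e = e and h = h and N = N, OF _ K _ _ step n])
        (use pos init C2_0 \<delta>0 H0 in \<open>auto simp: e_def t_def less_imp_le\<close>)
    also have "\<dots> \<le> T * (C\<^sub>2 * (\<delta> + H ^ p)) * exp (K * T)"
      using tT[OF n] t0[OF n] K C2_0 \<delta>0 H0 \<open>0 < T\<close>
      by (intro mult_mono) (auto simp: mult_left_mono)
    finally show "norm (\<Phi> (\<theta> n) - y (\<Sum>k<n. h k))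
        \<le> T * C\<^sub>2 * exp (K * T) * (Max ?S + (Max (h ` {..<N})) ^ p)"
      by (simp add: e_def t_def \<delta>_def H_def mult_ac)
  qed
qed

end
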